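(* Let $\mathbb{X}$ be a real reflexive Banach space with dual $\mathbb{X}^*$, and let $g:\mathbb{X}\to\mathbb{R}$ be proper, convex, lower semicontinuous, uniformly Fréchet differentiable, $\gamma$-strongly convex for some $\gamma>0$, strongly coercive and Legendre. Let $\mathcal{A}:\mathbb{X}\to\mathbb{X}^*$ be monotone and Lipschitz continuous with constant $L>0$, and let $\mathcal{B}:\mathbb{X}\to 2^{\mathbb{X}^*}$ be maximal monotone. Assume that $(\mathcal{A}+\mathcal{B})^{-1}(0^* ):=\{v\in\mathbb{X}: 0^*\in \mathcal{A}v+\mathcal{B}v\}\neq\emptyset$. Let $\alpha\in(0,1)$ satisfy $\alpha\in\left(\delta,\frac{\gamma(1-2\delta)}{2}\right)$ for some $\delta\in(0,\frac12)$, let $\mu_0,\mu_1>0$, and let $\{d_n\}$ be a nonnegative real sequence with $\sum_{n=1}^\infty d_n<\infty$. For arbitrary $v_0,v_1\in\mathbb{X}$ define, for $n\ge1$, $$v_{n+1}=\mathrm{Res}^g_{\mu_n\mathcal{B}}\Big(\nabla g^*\big(\nabla g(v_n)-\left((\mu_n+\mu_{n-1})\mathcal{A}v_n-\mu_{n-1}\mathcal{A}v_{n-1}\right)\big)\Big),$$ $$\mu_{n+1}=\begin{cases}\min\left\{\dfrac{\alpha\|v_n-v_{n+1}\|}{\|\mathcal{A}v_n-\mathcal{A}v_{n+1}\|},\ \mu_n+d_n\right\}, & \text{if } \mathcal{A}v_n\neq\mathcal{A}v_{n+1},\\ \mu_n+d_n, & \text{otherwise.}\end{cases}$$ Then $\min_{1\le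 j\le n}\|v_{j+1}-v_j\|=\mathcal{O}(1/\sqrt{n})$ as $n\to\infty$.
   Context: $0^*$ is the zero of $\mathbb{X}^*$. $g^*(x^* )=\sup_{x\in\mathbb{X}}\{\langle x^*,x\rangle-g(x)\}$ is the Fenchel conjugate of $g$. Conditions on $g$: $g$ is uniformly Fréchet differentiable if the limit $\langle\nabla g(x),y\rangle=\lim_{\lambda\to0}\frac{g(x+\lambda y)-g(x)}{\lambda}$ is attained uniformly for $x\in\mathbb{X}$ and $\|y\|=1$. $g$ is $\gamma$-strongly convex if $\langle\nabla g(x)-\nabla g(y),x-y\rangle\ge\gamma\|x-y\|^2$ for all $x,y$. $g$ is strongly coercive if $g(x)/\|x\|\to+\infty$ as $\|x\|\to\infty$. $g$ is Legendre if $g$ and $g^*$ are Gâteaux differentiable on the interiors of their domains, these interiors are nonempty, and the domains of $\nabla g$ and $\nabla g^*$ equal $\mathrm{int}(\mathrm{dom}\, g)$ and $\mathrm{int}(\mathrm{dom}\, g^* )$ respectively. Under these conditions $\nabla g:\mathbb{X}\to\mathbb{X}^*$ is a bijection, $\mathrm{dom}\,g^*=\mathbb{X}^*$ and $\nabla g^*=(\nabla g)^{-1}$. Resolvent: for $\mu>0$, $\mathrm{Res}^g_{\mu\mathcal{B}}:=(\nabla g+\mu\mathcal{B})^{-1}\circ\nabla g$, which is single-valued and everywhere defined for $\mathcal{B}$ maximal monotone. $\mathcal{A}$ is monotone if $\langle\mathcal{A}x-\mathcal{A}y,x-y\rangle\ge0$ for all $x,y$. $\mathcal{B}$ is monotone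 if $\langle u-v,x-y\rangle\ge 0$ whenever $u\in\mathcal{B}x$, $v\in\mathcal{B}y$, and maximal monotone if its graph is not properly contained in the graph of another monotone operator. Norms of elements of $\mathbb{X}$ and of $\mathbb{X}^*$ are the norm and dual norm. *)

theory Defs
  imports "HOL-Analysis.Analysis" "HOL-Library.Landau_Symbols"
begin

text \<open>
  The dual of a real normed space \<open>'a\<close> is \<open>'a \<Rightarrow>\<^sub>L real\<close>; the norm of \<open>blinfun\<close> is the
  operator norm, that is, the dual norm.
\<close>

definition canonical_embedding ::
    "'a::real_normed_vector \<Rightarrow> (('a \<Rightarrow>\<^sub>L real) \<Rightarrow>\<^sub>L real)" where
  "canonical_embedding = blinfun.prod_left"

definition reflexive_space :: "'a::real_normed_vector itself \<Rightarrow> bool" where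
  "reflexive_space _ \<longleftrightarrow> surj (canonical_embedding :: 'a \<Rightarrow> _)"

definition effective_domain :: "('b \<Rightarrow> ereal) \<Rightarrow> 'b set" where
  "effective_domain \<phi> = {x. \<phi> x < \<infinity>}"

definition proper :: "('b \<Rightarrow> ereal) \<Rightarrow> bool" where
  "proper \<phi> \<longleftrightarrow> effective_domain \<phi> \<noteq> {} \<and> (\<forall>x. \<phi> x \<noteq> - \<infinity>)"

definition lower_semicontinuous :: "('b::topological_space \<Rightarrow> ereal) \<Rightarrow> bool" where
  "lower_semicontinuous \<phi> \<longleftrightarrow> (\<forall>x. \<phi> x \<le> Liminf (at x) \<phi>)"

definition fenchel_conjugate ::
    "('b::real_normed_vector \<Rightarrow> ereal) \<Rightarrow> ('b \<Rightarrow>\<^sub>L real) \<Rightarrow> ereal" where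
  "fenchel_conjugate \<phi> f = (SUP x. ereal (blinfun_apply f x) - \<phi> x)"

text \<open>
  The difference quotient is formed in \<open>ereal\<close>, so that a point of the domain at which \<open>\<phi>\<close> takes
  the value \<open>\<infinity>\<close> arbitrarily close by in some direction has no derivative.
\<close>

definition has_gateaux_derivative ::
    "('b::real_normed_vector \<Rightarrow> ereal) \<Rightarrow> ('b \<Rightarrow>\<^sub>L real) \<Rightarrow> 'b \<Rightarrow> bool" where
  "has_gateaux_derivative \<phi> D x \<longleftrightarrow>
     \<bar>\<phi> x\<bar> \<noteq> \<infinity> \<and>
     (\<forall>y. ((\<lambda>t. (\<phi> (x + t *\<^sub>R y) - \<phi> x) / ereal t) \<longlongrightarrow> ereal (blinfun_apply D y)) (at 0))"

definition gateaux_differentiable :: "('b::real_normed_vector \<Rightarrow> ereal) \<Rightarrow> 'b \<Rightarrow> bool" where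
  "gateaux_differentiable \<phi> x \<longleftrightarrow> (\<exists>D. has_gateaux_derivative \<phi> D x)"

definition gradient :: "('b::real_normed_vector \<Rightarrow> ereal) \<Rightarrow> 'b \<Rightarrow> ('b \<Rightarrow>\<^sub>L real)" where
  "gradient \<phi> x = (THE D. has_gateaux_derivative \<phi> D x)"

definition gradient_domain :: "('b::real_normed_vector \<Rightarrow> ereal) \<Rightarrow> 'b set" where
  "gradient_domain \<phi> = {x. gateaux_differentiable \<phi> x}"

definition legendre :: "('b::real_normed_vector \<Rightarrow> ereal) \<Rightarrow> bool" where
  "legendre \<phi> \<longleftrightarrow>
     interior (effective_domain \<phi>) \<noteq> {} \<and>
     (\<forall>x \<in> interior (effective_domain \<phi>). gateaux_differentiable \<phi> x) \<and>
     gradient_domain \<phi> = interior (effective_domain \<phi>) \<and>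
     interior (effective_domain (fenchel_conjugate \<phi>)) \<noteq> {} \<and>
     (\<forall>f \<in> interior (effective_domain (fenchel_conjugate \<phi>)).
        gateaux_differentiable (fenchel_conjugate \<phi>) f) \<and>
     gradient_domain (fenchel_conjugate \<phi>) = interior (effective_domain (fenchel_conjugate \<phi>))"

definition nabla :: "('a::real_normed_vector \<Rightarrow> real) \<Rightarrow> 'a \<Rightarrow> ('a \<Rightarrow>\<^sub>L real)" where
  "nabla g = gradient (\<lambda>x. ereal (g x))"

text \<open>
  The gradient of the conjugate takes values in the bidual; on a reflexive space it is read as a
  point of the space itself.
\<close>

definition nabla_conj :: "('a::real_normed_vector \<Rightarrow> real) \<Rightarrow> ('a \<Rightarrow>\<^sub>L real) \<Rightarrow> 'a" where
  "nabla_conj g f =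
     inv canonical_embedding (gradient (fenchel_conjugate (\<lambda>x. ereal (g x))) f)"

definition uniformly_frechet_differentiable :: "('a::real_normed_vector \<Rightarrow> real) \<Rightarrow> bool" where
  "uniformly_frechet_differentiable g \<longleftrightarrow>
     (\<forall>x. gateaux_differentiable (\<lambda>x. ereal (g x)) x) \<and>
     uniform_limit (UNIV \<times> sphere 0 1)
       (\<lambda>t (x, y). (g (x + t *\<^sub>R y) - g x) / t)
       (\<lambda>(x, y). blinfun_apply (nabla g x) y)
       (at 0)"

definition strongly_convex :: "real \<Rightarrow> ('a::real_normed_vector \<Rightarrow> real) \<Rightarrow> bool" where
  "strongly_convex \<gamma> g \<longleftrightarrow>
     (\<forall>x y. blinfun_apply (nabla g x - nabla g y) (x - y) \<ge> \<gamma> * (norm (x - y))\<^sup>2)"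

definition strongly_coercive :: "('a::real_normed_vector \<Rightarrow> real) \<Rightarrow> bool" where
  "strongly_coercive g \<longleftrightarrow> filterlim (\<lambda>x. g x / norm x) at_top at_infinity"

definition monotone_mapping :: "('a::real_normed_vector \<Rightarrow> ('a \<Rightarrow>\<^sub>L real)) \<Rightarrow> bool" where
  "monotone_mapping A \<longleftrightarrow> (\<forall>x y. blinfun_apply (A x - A y) (x - y) \<ge> 0)"

definition monotone_operator :: "('a::real_normed_vector \<Rightarrow> ('a \<Rightarrow>\<^sub>L real) set) \<Rightarrow> bool" where
  "monotone_operator B \<longleftrightarrow>
     (\<forall>x y. \<forall>u \<in> B x. \<forall>v \<in> B y. blinfun_apply (u - v) (x - y) \<ge> 0)"

definition operator_graph :: "('a \<Rightarrow> 'b set) \<Rightarrow> ('a \<times> 'b) set" where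
  "operator_graph B = {(x, u). u \<in> B x}"

definition maximal_monotone :: "('a::real_normed_vector \<Rightarrow> ('a \<Rightarrow>\<^sub>L real) set) \<Rightarrow> bool" where
  "maximal_monotone B \<longleftrightarrow>
     monotone_operator B \<and>
     \<not> (\<exists>B'. monotone_operator B' \<and> operator_graph B \<subset> operator_graph B')"

definition operator_inverse :: "('a \<Rightarrow> 'b set) \<Rightarrow> 'b \<Rightarrow> 'a set" where
  "operator_inverse T u = {x. u \<in> T x}"

definition scaled_operator ::
    "real \<Rightarrow> ('a \<Rightarrow> 'b::real_vector set) \<Rightarrow> 'a \<Rightarrow> 'b set" where
  "scaled_operator \<mu> B x = (\<lambda>u. \<mu> *\<^sub>R u) ` B x"

text \<open>
  The resolvent is kept as the set-valued composition by which it is defined, applied to a point.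
  When it is single-valued, \<open>z = Res x\<close> is membership of \<open>z\<close> in this set.
\<close>

definition resolvent ::
    "('a::real_normed_vector \<Rightarrow> real) \<Rightarrow> real \<Rightarrow> ('a \<Rightarrow> ('a \<Rightarrow>\<^sub>L real) set) \<Rightarrow> 'a \<Rightarrow> 'a set" where
  "resolvent g \<mu> B x =
     operator_inverse (\<lambda>z. nabla g z +o scaled_operator \<mu> B z) (nabla g x)"

end

theory Submission
  imports Defs
begin

text \<open>
  Write \<open>D(x, y) = g x - g y - \<langle>\<nabla>g y, x - y\<rangle>\<close>, let \<open>p\<close> be a zero of \<open>A + B\<close> and put
  \<open>T\<^sub>n = D(p, v\<^sub>n) - \<mu>\<^sub>n\<^sub>-\<^sub>1 \<langle>A v\<^sub>n - A v\<^sub>n\<^sub>-\<^sub>1, v\<^sub>n - p\<rangle>\<close>. The three-point identity for \<open>D\<close> and monotonicity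
  of \<open>A\<close> and \<open>B\<close> give
  \<open>T\<^sub>n\<^sub>+\<^sub>1 \<le> T\<^sub>n - D(v\<^sub>n\<^sub>+\<^sub>1, v\<^sub>n) - \<mu>\<^sub>n\<^sub>-\<^sub>1 \<langle>A v\<^sub>n - A v\<^sub>n\<^sub>-\<^sub>1, v\<^sub>n\<^sub>+\<^sub>1 - v\<^sub>n\<rangle>\<close>.
  The step sizes converge to a positive limit, so \<open>\<mu>\<^sub>n\<^sub>-\<^sub>1 / \<mu>\<^sub>n\<close> tends to \<open>1\<close> and the last term is at
  most \<open>\<beta> \<parallel>v\<^sub>n - v\<^sub>n\<^sub>-\<^sub>1\<parallel> \<parallel>v\<^sub>n\<^sub>+\<^sub>1 - v\<^sub>n\<parallel>\<close> for large \<open>n\<close>, where \<open>\<alpha> < \<beta> < \<gamma>/2\<close>. Since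
  \<open>D(x, y) \<ge> \<gamma>/2 \<parallel>x - y\<parallel>\<^sup>2\<close>, the quantity \<open>T\<^sub>n + \<beta>/2 \<parallel>v\<^sub>n - v\<^sub>n\<^sub>-\<^sub>1\<parallel>\<^sup>2\<close> is nonnegative and decreases by at
  least \<open>(\<gamma>/2 - \<beta>) \<parallel>v\<^sub>n\<^sub>+\<^sub>1 - v\<^sub>n\<parallel>\<^sup>2\<close>, whence \<open>\<parallel>v\<^sub>n\<^sub>+\<^sub>1 - v\<^sub>n\<parallel>\<^sup>2\<close> is summable.
\<close>

section \<open>Gateaux derivatives\<close>

lemma has_gateaux_derivative_unique:
  assumes "has_gateaux_derivative \<phi> D x" "has_gateaux_derivative \<phi> E x"
  shows "D = E"
proof (rule blinfun_eqI)
  fix y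
  let ?q = "\<lambda>t. (\<phi> (x + t *\<^sub>R y) - \<phi> x) / ereal t"
  have "(?q \<longlongrightarrow> ereal (blinfun_apply D y)) (at 0)" "(?q \<longlongrightarrow> ereal (blinfun_apply E y)) (at 0)"
    using assms by (auto simp: has_gateaux_derivative_def)
  then have "ereal (blinfun_apply D y) = ereal (blinfun_apply E y)"
    by (rule tendsto_unique[OF trivial_limit_at])
  then show "blinfun_apply D y = blinfun_apply E y" by simp
qed

lemma has_gateaux_derivative_gradient:
  assumes "gateaux_differentiable \<phi> x"
  shows "has_gateaux_derivative \<phi> (gradient \<phi> x) x"
proof -
  have "\<exists>!D. has_gateaux_derivative \<phi> D x"
    using assms has_gateaux_derivative_unique by (auto simp: gateaux_differentiable_def)
  then show ?thesis unfolding gradient_def by (rule theI')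
qed

lemma has_gateaux_derivative_ereal_iff:
  "has_gateaux_derivative (\<lambda>x. ereal (g x)) D x \<longleftrightarrow>
     (\<forall>y. ((\<lambda>t. (g (x + t *\<^sub>R y) - g x) / t) \<longlongrightarrow> blinfun_apply D y) (at 0))"
proof -
  have "((\<lambda>t. (ereal (g (x + t *\<^sub>R y)) - ereal (g x)) / ereal t) \<longlongrightarrow> ereal c) (at 0) \<longleftrightarrow>
        ((\<lambda>t. (g (x + t *\<^sub>R y) - g x) / t) \<longlongrightarrow> c) (at 0)" for y c
    by (subst lim_ereal[symmetric], rule tendsto_cong)
      (auto simp: eventually_at_filter)
  then show ?thesis by (simp add: has_gateaux_derivative_def)
qed

lemma has_real_derivative_along_line:
  assumes "gateaux_differentiable (\<lambda>x. ereal (g x)) (y + s *\<^sub>R h)"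
  shows "((\<lambda>s. g (y + s *\<^sub>R h)) has_real_derivative blinfun_apply (nabla g (y + s *\<^sub>R h)) h) (at s)"
  using has_gateaux_derivative_gradient[OF assms]
  unfolding has_gateaux_derivative_ereal_iff nabla_def DERIV_def
  by (simp add: algebra_simps)

section \<open>Bregman distance\<close>

definition bregman :: "('a::real_normed_vector \<Rightarrow> real) \<Rightarrow> 'a \<Rightarrow> 'a \<Rightarrow> real" where
  "bregman g x y = g x - g y - blinfun_apply (nabla g y) (x - y)"

lemma bregman_three_point:
  "blinfun_apply (nabla g y - nabla g z) (z - p) = bregman g p y - bregman g p z - bregman g z y"
  by (simp add: bregman_def blinfun.diff_left blinfun.diff_right)

text \<open>Strong monotonicity of the gradient is integrated along the segment from
  \<open>y\<close> to \<open>x\<close>; \<open>\<psi> 1 - \<psi> 0\<close> is the difference of the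
  two sides.\<close>

lemma bregman_lower_bound:
  assumes diff: "\<And>x. gateaux_differentiable (\<lambda>x. ereal (g x)) x"
    and sc: "strongly_convex \<gamma> g"
  shows "\<gamma> / 2 * (norm (x - y))\<^sup>2 \<le> bregman g x y"
proof -
  define h where "h = x - y"
  define \<psi> where "\<psi> s = g (y + s *\<^sub>R h) - s * blinfun_apply (nabla g y) h
      - \<gamma> / 2 * s\<^sup>2 * (norm h)\<^sup>2" for s
  have "\<psi> 0 \<le> \<psi> 1"
  proof (rule DERIV_nonneg_imp_nondecreasing, simp)
    fix s :: real assume s: "0 \<le> s" "s \<le> 1"
    let ?d = "blinfun_apply (nabla g (y + s *\<^sub>R h)) h - blinfun_apply (nabla g y) h
        - \<gamma> * s * (norm h)\<^sup>2"
    have "(\<psi> has_real_derivative ?d) (at s)"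
      unfolding \<psi>_def
      by (rule derivative_eq_intros has_real_derivative_along_line diff refl | simp)+
    moreover have "?d \<ge> 0"
    proof (cases "s = 0")
      case False
      have "\<gamma> * (norm ((y + s *\<^sub>R h) - y))\<^sup>2
          \<le> blinfun_apply (nabla g (y + s *\<^sub>R h) - nabla g y) ((y + s *\<^sub>R h) - y)"
        using sc unfolding strongly_convex_def by blast
      then have "s * ?d \<ge> 0"
        by (simp add: blinfun.diff_left blinfun.scaleR_right algebra_simps power2_eq_square)
      moreover have "s > 0" using s False by simp
      ultimately show ?thesis by (simp only: zero_le_mult_iff) auto
    qed simp
    ultimately show "\<exists>d. (\<psi> has_real_derivative d) (at s) \<and> d \<ge> 0" by blast
  qed
  then show ?thesis by (simp add: \<psi>_def h_def bregman_def)
qed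

section \<open>Fenchel conjugate and inversion of the gradient\<close>

lemma fenchel_conjugate_le_iff:
  "fenchel_conjugate (\<lambda>x. ereal (g x)) f \<le> ereal c \<longleftrightarrow> (\<forall>x. blinfun_apply f x - g x \<le> c)"
  by (simp add: fenchel_conjugate_def SUP_le_iff)

lemma fenchel_conjugate_ge:
  "ereal (blinfun_apply f x - g x) \<le> fenchel_conjugate (\<lambda>x. ereal (g x)) f"
  unfolding fenchel_conjugate_def by (rule SUP_upper2[of x]) auto

lemma fenchel_conjugate_finite:
  assumes diff: "\<And>x. gateaux_differentiable (\<lambda>x. ereal (g x)) x"
    and sc: "strongly_convex \<gamma> g" and "\<gamma> > 0"
  shows "\<bar>fenchel_conjugate (\<lambda>x. ereal (g x)) f\<bar> \<noteq> \<infinity>"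
proof -
  define k where "k = norm (f - nabla g 0)"
  \<comment> \<open>The quadratic growth of \<open>g\<close> beats the linear term:
    \<open>k\<^sup>2 / (2 * \<gamma>)\<close> is the maximum of
    \<open>k * r - \<gamma> / 2 * r\<^sup>2\<close> over real \<open>r\<close>.\<close>
  have "blinfun_apply f x - g x \<le> k\<^sup>2 / (2 * \<gamma>) - g 0" for x
  proof -
    have "blinfun_apply (f - nabla g 0) x \<le> k * norm x"
      using norm_blinfun[of "f - nabla g 0" x] by (simp add: k_def)
    moreover have "\<gamma> / 2 * (norm x)\<^sup>2 \<le> bregman g x 0"
      using bregman_lower_bound[OF diff sc, of x 0] by simp
    moreover have "k * norm x \<le> k\<^sup>2 / (2 * \<gamma>) + \<gamma> / 2 * (norm x)\<^sup>2"
    proof -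
      have "k\<^sup>2 / (2 * \<gamma>) + \<gamma> / 2 * (norm x)\<^sup>2 - k * norm x = (k - \<gamma> * norm x)\<^sup>2 / (2 * \<gamma>)"
        using \<open>\<gamma> > 0\<close> by (simp add: field_simps power2_eq_square)
      also have "\<dots> \<ge> 0" using \<open>\<gamma> > 0\<close> by simp
      finally show ?thesis by simp
    qed
    ultimately show ?thesis by (simp add: bregman_def blinfun.diff_left)
  qed
  then have "fenchel_conjugate (\<lambda>x. ereal (g x)) f \<le> ereal (k\<^sup>2 / (2 * \<gamma>) - g 0)"
    by (simp add: fenchel_conjugate_le_iff)
  moreover note fenchel_conjugate_ge[of f 0 g]
  ultimately show ?thesis by auto
qed

text \<open>
  No biconjugate theorem is needed: since \<open>g\<^sup>*\<close> is known explicitly at \<open>\<nabla>g x\<close>, the gradient inequality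
  for \<open>g\<^sup>*\<close> between \<open>f\<close> and \<open>\<nabla>g x\<close>, where \<open>x = \<nabla>g\<^sup>* f\<close>, already yields equality in the
  Fenchel--Young inequality for \<open>x\<close> and \<open>f\<close>.
\<close>

lemma nabla_nabla_conj:
  fixes g :: "'a::real_normed_vector \<Rightarrow> real"
  assumes refl: "reflexive_space TYPE('a)"
    and diff: "\<And>x. gateaux_differentiable (\<lambda>x. ereal (g x)) x"
    and sc: "strongly_convex \<gamma> g" and "\<gamma> > 0"
    and leg: "legendre (\<lambda>x. ereal (g x))"
  shows "nabla g (nabla_conj g f) = f"
proof -
  let ?G = "fenchel_conjugate (\<lambda>x. ereal (g x))"
  define G where "G u = real_of_ereal (?G u)" for u
  have G: "?G u = ereal (G u)" for u
    using fenchel_conjugate_finite[OF diff sc \<open>\<gamma> > 0\<close>, of u] by (simp add: G_def ereal_real)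
  have G_le: "G u \<le> c \<longleftrightarrow> (\<forall>x. blinfun_apply u x - g x \<le> c)" for u c
    using fenchel_conjugate_le_iff[of g u c] by (simp add: G)
  have G_ge: "blinfun_apply u x - g x \<le> G u" for u x
    using G_le[of u "G u"] by simp
  define x where "x = nabla_conj g f"
  have x: "canonical_embedding x = gradient ?G f"
    using refl by (simp add: x_def nabla_conj_def reflexive_space_def surj_f_inv_f)
  have "effective_domain ?G = UNIV" by (simp add: effective_domain_def G)
  with leg have "gateaux_differentiable ?G f" by (simp add: legendre_def)
  from has_gateaux_derivative_gradient[OF this]
  have lim: "((\<lambda>t. (G (f + t *\<^sub>R u) - G f) / t) \<longlongrightarrow> blinfun_apply u x) (at 0)" for u
    unfolding G has_gateaux_derivative_ereal_iff x[symmetric]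
    by (simp add: canonical_embedding_def)
  define h where "h = nabla g x"
  \<comment> \<open>\<open>G\<close> is a supremum of affine functions, so it lies below its chord
    from \<open>f\<close> to \<open>h\<close>; let \<open>t\<close> tend to 0 from the
    right.\<close>
  have "blinfun_apply (h - f) x \<le> G h - G f"
  proof (rule tendsto_upperbound[OF tendsto_within_subset[OF lim]])
    have "(G (f + t *\<^sub>R (h - f)) - G f) / t \<le> G h - G f" if t: "0 < t" "t < 1" for t
    proof -
      have "blinfun_apply (f + t *\<^sub>R (h - f)) y - g y \<le> (1 - t) * G f + t * G h" for y
      proof -
        have "(1 - t) * (blinfun_apply f y - g y) + t * (blinfun_apply h y - g y)
            \<le> (1 - t) * G f + t * G h"
          using t by (intro add_mono mult_left_mono G_ge) auto
        then show ?thesis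
          by (simp add: blinfun.add_left blinfun.diff_left blinfun.scaleR_left algebra_simps)
      qed
      then have "G (f + t *\<^sub>R (h - f)) \<le> (1 - t) * G f + t * G h" by (simp add: G_le)
      with t show ?thesis by (simp add: field_simps)
    qed
    then show "eventually (\<lambda>t. (G (f + t *\<^sub>R (h - f)) - G f) / t \<le> G h - G f) (at_right 0)"
      by (auto simp: eventually_at_right_field intro: exI[of _ 1])
  qed auto
  \<comment> \<open>By the gradient inequality for \<open>g\<close>, the supremum defining
    \<open>G h\<close> is attained at \<open>x\<close>.\<close>
  moreover have "G h \<le> blinfun_apply h x - g x"
    unfolding G_le
  proof
    fix y
    have "0 \<le> \<gamma> / 2 * (norm (y - x))\<^sup>2" using \<open>\<gamma> > 0\<close> by simp
    with bregman_lower_bound[OF diff sc, of y x]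
    show "blinfun_apply h y - g y \<le> blinfun_apply h x - g x"
      by (simp add: bregman_def h_def blinfun.diff_right)
  qed
  ultimately have Gf: "G f \<le> blinfun_apply f x - g x" by (simp add: blinfun.diff_left)
  show ?thesis
    unfolding x_def[symmetric]
  proof (rule blinfun_eqI)
    fix y
    \<comment> \<open>Equality in Fenchel--Young makes \<open>x\<close> a minimizer of
      \<open>g\<close> minus \<open>f\<close>, so the derivative along every line through
      \<open>x\<close> vanishes.\<close>
    have "((\<lambda>s. g (x + s *\<^sub>R y) - s * blinfun_apply f y) has_real_derivative
        blinfun_apply (nabla g x) y - blinfun_apply f y) (at 0)"
      using has_real_derivative_along_line[OF diff, where y = x and s = 0 and h = y]
      by (auto intro!: derivative_eq_intros)
    moreover have "g (x + 0 *\<^sub>R y) - 0 * blinfun_apply f y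
        \<le> g (x + s *\<^sub>R y) - s * blinfun_apply f y" for s
      using G_ge[of f "x + s *\<^sub>R y"] Gf by (simp add: blinfun.add_right blinfun.scaleR_right)
    ultimately have "blinfun_apply (nabla g x) y - blinfun_apply f y = 0"
      by (intro DERIV_local_min[of _ _ 0 1]) auto
    then show "blinfun_apply (nabla g x) y = blinfun_apply f y" by simp
  qed
qed

section \<open>Real sequences\<close>

lemma convergent_of_summable_increments:
  fixes \<mu> d :: "nat \<Rightarrow> real"
  assumes step: "\<And>n. \<mu> (Suc n) \<le> \<mu> n + d n"
    and "summable d" and d: "\<And>n. d n \<ge> 0"
    and lower: "\<And>n. m \<le> \<mu> n"
  shows "convergent \<mu>"
proof -
  \<comment> \<open>Removing the accumulated increments leaves a decreasing sequence that is bounded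
    below.\<close>
  define s where "s n = \<mu> n - (\<Sum>k<n. d k)" for n
  have "decseq s"
    using step by (intro decseq_SucI) (simp add: s_def algebra_simps)
  moreover have "m - suminf d \<le> s n" for n
    using lower[of n] sum_le_suminf[OF \<open>summable d\<close>, of "{..<n}"] d by (simp add: s_def)
  ultimately have "convergent s"
    using decseq_convergent convergent_def by metis
  moreover have "convergent (\<lambda>n. \<Sum>k<n. d k)"
    using \<open>summable d\<close> by (simp add: summable_iff_convergent)
  ultimately have "convergent (\<lambda>n. s n + (\<Sum>k<n. d k))" by (rule convergent_add)
  then show ?thesis by (simp add: s_def)
qed

text \<open>Telescoping from \<open>N\<close> bounds the partial sums of the tail by
  \<open>E N / c\<close>.\<close>

lemma summable_of_descent:
  fixes f E :: "nat \<Rightarrow> real"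
  assumes "c > 0" and nonneg: "\<And>n. 0 \<le> f n" "\<And>n. n \<ge> N \<Longrightarrow> 0 \<le> E n"
    and step: "\<And>n. n \<ge> N \<Longrightarrow> E (Suc n) + c * f n \<le> E n"
  shows "summable f"
proof -
  have "E (N + n) + c * (\<Sum>k<n. f (N + k)) \<le> E N" for n
  proof (induction n)
    case (Suc n)
    with step[of "N + n"] show ?case by (simp add: algebra_simps)
  qed simp
  then have "(\<Sum>k<n. f (N + k)) \<le> E N / c" for n
    using nonneg(2)[of "N + n"] \<open>c > 0\<close> by (smt (verit) le_add1 mult.commute pos_le_divide_eq)
  then have "summable (\<lambda>n. f (N + n))"
    by (intro summableI_nonneg_bounded[of _ "E N / c"] nonneg)
  then show ?thesis by (simp add: add.commute[of N])
qed

text \<open>\<open>n\<close> times the squared minimum is at most the total sum of squares, whose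
  root serves as the constant.\<close>

lemma Min_bigo_of_summable_squares:
  fixes a :: "nat \<Rightarrow> real"
  assumes "summable (\<lambda>n. (a n)\<^sup>2)" and nonneg: "\<And>n. a n \<ge> 0"
  shows "(\<lambda>n. MIN j\<in>{1..n}. a j) \<in> O(\<lambda>n. 1 / sqrt (real n))"
proof (rule bigoI[of _ "sqrt (\<Sum>n. (a n)\<^sup>2)"], rule eventually_sequentiallyI[of 1])
  fix n :: nat assume n: "1 \<le> n"
  let ?m = "MIN j\<in>{1..n}. a j"
  have "?m \<in> a ` {1..n}" using n by (intro Min_in) auto
  then have m: "?m \<ge> 0" using nonneg by auto
  have "real n * ?m\<^sup>2 = (\<Sum>j\<in>{1..n}. ?m\<^sup>2)" by simp
  also have "\<dots> \<le> (\<Sum>j\<in>{1..n}. (a j)\<^sup>2)"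
    using m by (intro sum_mono power_mono) auto
  also have "\<dots> \<le> (\<Sum>n. (a n)\<^sup>2)" by (intro sum_le_suminf assms) auto
  finally have "sqrt (real n * ?m\<^sup>2) \<le> sqrt (\<Sum>n. (a n)\<^sup>2)" by simp
  then have "sqrt (real n) * ?m \<le> sqrt (\<Sum>n. (a n)\<^sup>2)"
    using m by (simp add: real_sqrt_mult)
  with n m show "norm ?m \<le> sqrt (\<Sum>n. (a n)\<^sup>2) * norm (1 / sqrt (real n))"
    by (simp add: field_simps)
qed

lemma blinfun_le_norm: "blinfun_apply f x \<le> norm f * norm x" for f :: "'a::real_normed_vector \<Rightarrow>\<^sub>L real"
  using norm_blinfun[of f x] by simp

lemma blinfun_ge_norm: "- (norm f * norm x) \<le> blinfun_apply f x" for f :: "'a::real_normed_vector \<Rightarrow>\<^sub>L real"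
  using norm_blinfun[of f x] by simp

theorem theorem4p10:
  fixes g :: "'a::banach \<Rightarrow> real"
    and A :: "'a \<Rightarrow> ('a \<Rightarrow>\<^sub>L real)"
    and B :: "'a \<Rightarrow> ('a \<Rightarrow>\<^sub>L real) set"
    and \<gamma> L \<alpha> \<delta> :: real
    and \<mu> d :: "nat \<Rightarrow> real"
    and v :: "nat \<Rightarrow> 'a"
  assumes "reflexive_space TYPE('a)"
    and "proper (\<lambda>x. ereal (g x))"
    and "convex_on UNIV g"
    and "lower_semicontinuous (\<lambda>x. ereal (g x))"
    and "uniformly_frechet_differentiable g"
    and "\<gamma> > 0"
    and "strongly_convex \<gamma> g"
    and "strongly_coercive g"
    and "legendre (\<lambda>x. ereal (g x))"
    and "monotone_mapping A"
    and "L > 0"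
    and "L-lipschitz_on UNIV A"
    and "maximal_monotone B"
    and "operator_inverse (\<lambda>x. A x +o B x) 0 \<noteq> {}"
    and "\<alpha> \<in> {0<..<1}"
    and "\<delta> \<in> {0<..<1/2}"
    and "\<alpha> \<in> {\<delta><..<\<gamma> * (1 - 2 * \<delta>) / 2}"
    and "\<mu> 0 > 0"
    and "\<mu> 1 > 0"
    and "\<And>n. n \<ge> 1 \<Longrightarrow> d n \<ge> 0"
    and "summable (\<lambda>n. d (Suc n))"
    and "\<And>n. n \<ge> 1 \<Longrightarrow>
           v (n + 1) \<in> resolvent g (\<mu> n) B
             (nabla_conj g
               (nabla g (v n) - ((\<mu> n + \<mu> (n - 1)) *\<^sub>R A (v n) - \<mu> (n - 1) *\<^sub>R A (v (n - 1)))))"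
    and "\<And>n. n \<ge> 1 \<Longrightarrow>
           \<mu> (n + 1) =
             (if A (v n) \<noteq> A (v (n + 1))
              then min (\<alpha> * norm (v n - v (n + 1)) / norm (A (v n) - A (v (n + 1)))) (\<mu> n + d n)
              else \<mu> n + d n)"
  shows "(\<lambda>n. MIN j\<in>{1..n}. norm (v (j + 1) - v j)) \<in> O(\<lambda>n. 1 / sqrt (real n))"
proof -
  have diff: "gateaux_differentiable (\<lambda>x. ereal (g x)) x" for x
    using assms(5) by (simp add: uniformly_frechet_differentiable_def)
  note breg = bregman_lower_bound[OF diff assms(7)]
  note nabla_conj = nabla_nabla_conj[OF assms(1) diff assms(7) assms(6) assms(9)]
  note A_mono = assms(10)[unfolded monotone_mapping_def, rule_format]
  have B_mono: "blinfun_apply (u - w) (x - y) \<ge> 0" if "u \<in> B x" "w \<in> B y" for u w x y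
    using assms(13) that by (auto simp: maximal_monotone_def monotone_operator_def)
  have A_lip: "norm (A x - A y) \<le> L * norm (x - y)" for x y
    using lipschitz_onD[OF assms(12), of x y] by (simp add: dist_norm)
  have \<alpha>: "0 < \<alpha>" using assms(15) by simp

  \<comment> \<open>Step sizes\<close>
  have \<mu>_step: "\<mu> (n + 1) \<le> \<mu> n + d n"
    and \<mu>_A: "\<mu> (n + 1) * norm (A (v (n + 1)) - A (v n)) \<le> \<alpha> * norm (v (n + 1) - v n)"
    and \<mu>_ge: "min (\<alpha> / L) (\<mu> n) \<le> \<mu> (n + 1)" if n: "n \<ge> 1" for n
  proof -
    show "\<mu> (n + 1) \<le> \<mu> n + d n" using assms(23)[OF n] by auto
    show "\<mu> (n + 1) * norm (A (v (n + 1)) - A (v n)) \<le> \<alpha> * norm (v (n + 1) - v n)"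
    proof (cases "A (v n) = A (v (n + 1))")
      case False
      then have "\<mu> (n + 1) \<le> \<alpha> * norm (v n - v (n + 1)) / norm (A (v n) - A (v (n + 1)))"
        using assms(23)[OF n] by simp
      with False show ?thesis by (simp add: pos_le_divide_eq norm_minus_commute)
    qed (use \<alpha> in simp)
    have "\<mu> n \<le> \<mu> n + d n" using assms(20)[OF n] by simp
    moreover have "\<alpha> / L \<le> \<alpha> * norm (v n - v (n + 1)) / norm (A (v n) - A (v (n + 1)))"
      if "A (v n) \<noteq> A (v (n + 1))"
      using mult_left_mono[OF A_lip[of "v n" "v (n + 1)"], of \<alpha>] \<alpha> assms(11) that
      by (simp add: field_simps)
    ultimately show "min (\<alpha> / L) (\<mu> n) \<le> \<mu> (n + 1)"
      using assms(23)[OF n] by (auto simp: min_def)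
  qed
  \<comment> \<open>The Lipschitz bound keeps the quotient in the step rule above
    \<open>\<alpha> / L\<close>, so no step from index 1 on falls below \<open>m\<close>.\<close>
  define m where "m = min (\<alpha> / L) (\<mu> 1)"
  have m: "m > 0" using \<alpha> assms(11,19) by (simp add: m_def)
  have \<mu>_m: "m \<le> \<mu> (Suc n)" for n
  proof (induction n)
    case (Suc n)
    with \<mu>_ge[of "Suc n"] show ?case by (simp add: m_def)
  qed (simp add: m_def)
  then have \<mu>_pos: "\<mu> n > 0" for n
    using m assms(18) by (cases n) (auto intro: less_le_trans)
  have "convergent (\<lambda>n. \<mu> (Suc n))"
    by (rule convergent_of_summable_increments[of _ "\<lambda>n. d (Suc n)" m])
      (use \<mu>_step assms(20,21) \<mu>_m in auto)
  then obtain l where l: "(\<lambda>n. \<mu> (Suc n)) \<longlonglongrightarrow> l" by (auto simp: convergent_def)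
  have "m \<le> l" by (rule LIMSEQ_le_const[OF l]) (use \<mu>_m in blast)
  with m have "l \<noteq> 0" by simp
  \<comment> \<open>Since \<open>\<delta>\<close> is positive, \<open>\<alpha>\<close> lies strictly
    below \<open>\<gamma> / 2\<close>; \<open>\<beta>\<close> leaves room for step ratios slightly
    above 1.\<close>
  obtain \<beta> where \<beta>: "\<alpha> < \<beta>" "\<beta> < \<gamma> / 2"
  proof -
    have "\<gamma> * (1 - 2 * \<delta>) / 2 < \<gamma> / 2" using assms(6,16) by (simp add: field_simps)
    then have "\<alpha> < \<gamma> / 2" using assms(17) by simp
    then show thesis using dense that by blast
  qed
  have "(\<lambda>n. \<mu> (Suc n) / \<mu> (Suc (Suc n)) * \<alpha>) \<longlonglongrightarrow> l / l * \<alpha>"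
    using l LIMSEQ_Suc[OF l] \<open>l \<noteq> 0\<close> by (intro tendsto_intros) auto
  then have "eventually (\<lambda>n. \<mu> (Suc n) / \<mu> (Suc (Suc n)) * \<alpha> < \<beta>) sequentially"
    using \<beta>(1) \<open>l \<noteq> 0\<close> by (intro order_tendstoD(2)) auto
  then obtain N where N: "\<mu> (Suc n) / \<mu> (Suc (Suc n)) * \<alpha> < \<beta>" if "n \<ge> N" for n
    by (auto simp: eventually_sequentially)

  define a where "a n = norm (v (n + 1) - v n)" for n
  define e where "e n = \<mu> n *\<^sub>R (A (v (n + 1)) - A (v n))" for n
  have e_norm: "norm (e n) \<le> \<beta> * a n" if n: "n \<ge> N + 1" for n
  proof -
    obtain k where k: "n = Suc k" "k \<ge> N" using n by (cases n) auto
    \<comment> \<open>The step rule controls this increment of \<open>A\<close> through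
      \<open>\<mu> (n + 1)\<close>, not \<open>\<mu> n\<close>; hence the ratio.\<close>
    have "norm (e n) = \<mu> n / \<mu> (n + 1) * (\<mu> (n + 1) * norm (A (v (n + 1)) - A (v n)))"
      using \<mu>_pos[of n] \<mu>_pos[of "n + 1"] by (simp add: e_def)
    also have "\<dots> \<le> \<mu> n / \<mu> (n + 1) * (\<alpha> * a n)"
      using \<mu>_pos[of n] \<mu>_pos[of "n + 1"] \<mu>_A[of n] n
      by (intro mult_left_mono) (auto simp: a_def)
    also have "\<dots> = (\<mu> n / \<mu> (n + 1) * \<alpha>) * a n" by simp
    also have "\<dots> \<le> \<beta> * a n"
      using N[OF k(2)] k(1) by (intro mult_right_mono) (auto simp: a_def)
    finally show ?thesis .
  qed

  \<comment> \<open>Descent inequality and summability\<close>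
  obtain p where p: "- A p \<in> B p"
  proof -
    obtain p where "0 \<in> A p +o B p" using assms(14) by (auto simp: operator_inverse_def)
    then obtain u where "u \<in> B p" "0 = A p + u" by (auto simp: elt_set_plus_def)
    then have "- A p \<in> B p" by (metis add_eq_0_iff)
    then show thesis by (rule that)
  qed
  \<comment> \<open>Shifted by one against the overview: this \<open>T n\<close> is its
    \<open>T\<^sub>n\<^sub>+\<^sub>1\<close>, which avoids the index \<open>n - 1\<close>.\<close>
  define T where "T n = bregman g p (v (n + 1)) - blinfun_apply (e n) (v (n + 1) - p)" for n
  have T_step: "T (n + 1) + bregman g (v (n + 2)) (v (n + 1))
      \<le> T n - blinfun_apply (e n) (v (n + 2) - v (n + 1))" for n
  proof -
    let ?w = "nabla g (v (n + 1)) -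
      ((\<mu> (n + 1) + \<mu> n) *\<^sub>R A (v (n + 1)) - \<mu> n *\<^sub>R A (v n))"
    have "v (n + 2) \<in> resolvent g (\<mu> (n + 1)) B (nabla_conj g ?w)"
      using assms(22)[of "n + 1"] by simp
    \<comment> \<open>\<open>nabla g\<close> cancels \<open>nabla_conj g\<close>, so membership in
      the resolvent becomes an equation in the dual.\<close>
    then obtain u where u: "u \<in> B (v (n + 2))"
      and w: "?w = nabla g (v (n + 2)) + \<mu> (n + 1) *\<^sub>R u"
      by (auto simp: resolvent_def operator_inverse_def nabla_conj elt_set_plus_def
          scaled_operator_def)
    \<comment> \<open>\<open>A p\<close> cancels when this is added to the monotonicity of
      \<open>A\<close>; pairing \<open>w\<close> with \<open>v (n + 2) - p\<close> then brings in
      the Bregman distances.\<close>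
    have "0 \<le> \<mu> (n + 1) * blinfun_apply (u - (- A p)) (v (n + 2) - p)"
      using B_mono[OF u p] \<mu>_pos[of "n + 1"] by simp
    moreover have "0 \<le> \<mu> (n + 1) * blinfun_apply (A (v (n + 2)) - A p) (v (n + 2) - p)"
      using A_mono \<mu>_pos[of "n + 1"] by simp
    moreover have "blinfun_apply ?w (v (n + 2) - p)
        = blinfun_apply (nabla g (v (n + 2)) + \<mu> (n + 1) *\<^sub>R u) (v (n + 2) - p)"
      by (simp only: w)
    moreover note bregman_three_point[of g "v (n + 1)" "v (n + 2)" p]
    ultimately show ?thesis
      by (simp add: T_def e_def blinfun.bilinear_simps algebra_simps)
  qed

  define E where "E n = T n + \<beta> / 2 * (a n)\<^sup>2" for n
  have "summable (\<lambda>n. (a (n + 1))\<^sup>2)"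
  proof (rule summable_of_descent[of "\<gamma> / 2 - \<beta>" _ "N + 1" E])
    fix n assume n: "n \<ge> N + 1"
    have amgm: "x * y \<le> (x\<^sup>2 + y\<^sup>2) / 2" for x y :: real
      using sum_squares_bound[of x y] by simp
    have bound: "norm (e n) * r \<le> \<beta> / 2 * ((a n)\<^sup>2 + r\<^sup>2)" if "r \<ge> 0" for r
    proof -
      have "norm (e n) * r \<le> \<beta> * (a n * r)"
        using mult_right_mono[OF e_norm[OF n] that] by (simp add: mult.assoc)
      also have "\<dots> \<le> \<beta> * (((a n)\<^sup>2 + r\<^sup>2) / 2)"
        using \<alpha> \<beta>(1) by (intro mult_left_mono amgm) auto
      finally show ?thesis by simp
    qed
    show "0 \<le> E n"
    proof -
      let ?r = "norm (v (n + 1) - p)"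
      \<comment> \<open>Of the bound on the error term, this part is absorbed by the Bregman
        distance in \<open>T n\<close>, the other by the square added in \<open>E n\<close>.\<close>
      have "\<beta> / 2 * ?r\<^sup>2 \<le> \<gamma> / 2 * ?r\<^sup>2"
        using \<beta> assms(6) by (intro mult_right_mono) auto
      then show ?thesis
        using breg[of p "v (n + 1)"] bound[of ?r] blinfun_le_norm[of "e n" "v (n + 1) - p"]
        by (simp add: E_def T_def norm_minus_commute[of p] distrib_left)
    qed
    \<comment> \<open>The Bregman distance supplies \<open>\<gamma> / 2\<close> times the new
      square; the cross term and \<open>E (Suc n)\<close> use \<open>\<beta> / 2\<close>
      each.\<close>
    show "E (Suc n) + (\<gamma> / 2 - \<beta>) * (a (n + 1))\<^sup>2 \<le> E n"
      using T_step[of n] breg[of "v (n + 2)" "v (n + 1)"] bound[of "a (n + 1)"]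
        blinfun_ge_norm[of "e n" "v (n + 2) - v (n + 1)"]
      by (simp add: E_def a_def algebra_simps)
  qed (use \<beta> in auto)
  then have "summable (\<lambda>n. (a n)\<^sup>2)" using summable_iff_shift[of "\<lambda>n. (a n)\<^sup>2" 1] by simp
  from Min_bigo_of_summable_squares[OF this] show ?thesis by (simp add: a_def)
qed

end
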